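(* Let $K$ be a field of characteristic $0$, let $d\ge 2$, let $C_d=x^d$ be the $d$-corona, and let $\sqrt[C_d]{1+x}$ be the $C_d$-th root of $1+x$, i.e. the unique $f\in K\{\{x\}\}$ with constant term $1$ and $f^{C_d}=1+x$. For $T\in\mathbb{P}$ denote by $\binom{C_d^{-1}}{T}$ the coefficient of $\sqrt[C_d]{1+x}$ relative to $T$ (the coefficient of $x^T$). Then $\binom{C_d^{-1}}{T}=0$ if there is a vertex $v$ in $T$ with $\mathrm{ar}_T(v)\ge d+1$. If $\mathrm{ar}_T(v)\le d$ for all vertices $v$ of $T$, then $$\binom{C_d^{-1}}{T}=(-1)^{n(T)-n_0(T)}\cdot\prod_{k\ge2}\left(\frac1k\binom{d-1}{k-1}\right)^{n_k(T)}.$$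
   Context: $\mathbb{P}$ is the set of isomorphism classes of finite planar reduced rooted trees: finite rooted trees in which the children of every vertex are linearly ordered and no vertex has exactly one child. The empty tree $\underline{1}$ is included in $\mathbb{P}$; $x$ also denotes the tree with a single vertex. The arity $\mathrm{ar}_T(v)$ of a vertex $v$ is its number of children (edges incident with $v$ that are not on the path from $v$ to the root); $n_k(T)$ is the number of vertices of $T$ of arity $k$; $n(T)=\sum_{k\ge0}n_k(T)$ is the total number of vertices; $n_0(T)=\deg(T)$ is the number of leaves. The $d$-corona $C_d$ is the tree consisting of a root with $d$ children, all of them leaves. For $m\ge 2$ and nonempty $T_1,\dots,T_m$, the $m$-ary grafting $\cdot_m(T_1,\dots,T_m)$ is the tree whose root has exactly $m$ children, which are, in order, the roots of $T_1,\dots,T_m$. Empty trees are omitted in graftings: if exactly $k$ of the $m$ trees are nonempty, the result is the $k$-ary grafting of these in order if $k\ge 2$, the single nonempty tree if $k=1$, and $\underline{1}$ if $k=0$. $K\{\{x\}\}$ (planar power series) is the set of all formal sums $\sum_{S\in\mathbb{P}}a_S x^S$ with $a_S\in K$, where $x^{\underline{1}}=1$ and $x^x=x$; the constant term is $a_{\underline{1}}$. The operations $\cdot_m$ are extended $K$-multilinearly to formal sums. The $C_d$-th power is $f^{C_d}=\cdot_d(f,\dots,f)$ ($d$ arguments).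
   Formalization: The formula is proved with an additional factor (1/d)^{n_0(T)} on the right-hand side; as printed it fails already at T = x, where f^{C_d} = 1+x forces the coefficient 1/d but the printed formula gives 1. *)

theory Defs
  imports Complex_Main
begin

section \<open>Planar rooted trees\<close>

text \<open>
  A value of this datatype is an isomorphism class of nonempty finite planar rooted trees, given
  by the ordered list of the subtrees at the children of the root.
\<close>

datatype ptree = Node (children: "ptree list")

text \<open>A vertex is addressed by the sequence of child positions on the path from the root to it.\<close>

fun subtree_at :: "ptree \<Rightarrow> nat list \<Rightarrow> ptree option" where
  "subtree_at t [] = Some t"
| "subtree_at t (i # p) =
     (if i < length (children t) then subtree_at (children t ! i) p else None)"

definition ptree_vertices :: "ptree \<Rightarrow> nat list set" where
  "ptree_vertices t = {p. subtree_at t p \<noteq> None}"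

definition ptree_arity :: "ptree \<Rightarrow> nat list \<Rightarrow> nat" where
  "ptree_arity t p = length (children (the (subtree_at t p)))"

definition reduced :: "ptree \<Rightarrow> bool" where
  "reduced t \<longleftrightarrow> (\<forall>p\<in>ptree_vertices t. ptree_arity t p \<noteq> 1)"

text \<open>The set of planar reduced rooted trees; \<^term>\<open>None\<close> represents the empty tree.\<close>

typedef planar_tree = "{T :: ptree option. \<forall>t. T = Some t \<longrightarrow> reduced t}"
  by (rule exI[of _ None]) simp

definition empty_tree :: planar_tree where
  "empty_tree = Abs_planar_tree None"

definition leaf :: planar_tree where
  "leaf = Abs_planar_tree (Some (Node []))"

definition vertices :: "planar_tree \<Rightarrow> nat list set" where
  "vertices T = (case Rep_planar_tree T of None \<Rightarrow> {} | Some t \<Rightarrow> ptree_vertices t)"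

definition arity :: "planar_tree \<Rightarrow> nat list \<Rightarrow> nat" where
  "arity T v = ptree_arity (the (Rep_planar_tree T)) v"

definition num_vertices :: "planar_tree \<Rightarrow> nat" where
  "num_vertices T = card (vertices T)"

definition num_arity :: "nat \<Rightarrow> planar_tree \<Rightarrow> nat" where
  "num_arity k T = card {v \<in> vertices T. arity T v = k}"

section \<open>Grafting\<close>

definition nonempty_trees :: "planar_tree list \<Rightarrow> ptree list" where
  "nonempty_trees Ts = List.map_filter Rep_planar_tree Ts"

definition graft :: "planar_tree list \<Rightarrow> planar_tree" where
  "graft Ts = Abs_planar_tree
     (case nonempty_trees Ts of
        [] \<Rightarrow> None
      | [t] \<Rightarrow> Some t
      | ts \<Rightarrow> Some (Node ts))"

lemma reduced_Node:
  "reduced (Node ts) \<longleftrightarrow> length ts \<noteq> 1 \<and> (\<forall>t\<in>set ts. reduced t)"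
proof
  assume r: "reduced (Node ts)"
  have "length ts \<noteq> 1"
    using r[unfolded reduced_def, rule_format, of "[]"]
    by (simp add: ptree_vertices_def ptree_arity_def)
  moreover have "reduced t" if t: "t \<in> set ts" for t
    unfolding reduced_def
  proof
    fix p assume p: "p \<in> ptree_vertices t"
    obtain i where i: "i < length ts" "ts ! i = t"
      using t by (auto simp: in_set_conv_nth)
    show "ptree_arity t p \<noteq> 1"
      using r[unfolded reduced_def, rule_format, of "i # p"] i p
      by (simp add: ptree_vertices_def ptree_arity_def)
  qed
  ultimately show "length ts \<noteq> 1 \<and> (\<forall>t\<in>set ts. reduced t)" by blast
next
  assume r: "length ts \<noteq> 1 \<and> (\<forall>t\<in>set ts. reduced t)"
  show "reduced (Node ts)"
    unfolding reduced_def
  proof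
    fix p assume p: "p \<in> ptree_vertices (Node ts)"
    show "ptree_arity (Node ts) p \<noteq> 1"
    proof (cases p)
      case Nil
      then show ?thesis using r by (simp add: ptree_arity_def)
    next
      case (Cons i q)
      then have i: "i < length ts" "q \<in> ptree_vertices (ts ! i)"
        using p by (auto simp: ptree_vertices_def split: if_splits)
      then have "ptree_arity (ts ! i) q \<noteq> 1"
        using r by (simp add: reduced_def)
      then show ?thesis using i Cons by (simp add: ptree_arity_def)
    qed
  qed
qed

lemma reduced_nonempty_trees: "t \<in> set (nonempty_trees Ts) \<Longrightarrow> reduced t"
  using Rep_planar_tree by (fastforce simp: nonempty_trees_def List.map_filter_def)

lemma Rep_graft:
  "Rep_planar_tree (graft Ts) =
     (case nonempty_trees Ts of
        [] \<Rightarrow> None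
      | [t] \<Rightarrow> Some t
      | ts \<Rightarrow> Some (Node ts))"
  unfolding graft_def
  by (rule Abs_planar_tree_inverse)
     (use reduced_nonempty_trees[of _ Ts] in \<open>auto simp: reduced_Node split: list.splits\<close>)

section \<open>Planar power series\<close>

text \<open>The value at \<open>T\<close> is the coefficient of \<open>x\<^sup>T\<close>.\<close>

type_synonym 'a planar_series = "planar_tree \<Rightarrow> 'a"

definition monomial :: "planar_tree \<Rightarrow> 'a::field_char_0 planar_series" where
  "monomial S = (\<lambda>T. if T = S then 1 else 0)"

text \<open>
  Multilinear extension of the \<open>m\<close>-ary grafting, \<open>m\<close> being the length of the argument list. The
  sum is finite, see \<open>finite_graft_fiber\<close> below.
\<close>

definition series_graft :: "'a::field_char_0 planar_series list \<Rightarrow> 'a planar_series" where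
  "series_graft fs = (\<lambda>T. \<Sum>Ts | length Ts = length fs \<and> graft Ts = T.
     \<Prod>i<length fs. (fs ! i) (Ts ! i))"

lemma finite_graft_fiber: "finite {Ts. length Ts = m \<and> graft Ts = T}"
proof -
  define C where "C = (case Rep_planar_tree T of None \<Rightarrow> {} | Some t \<Rightarrow> insert t (set (children t)))"
  define B where "B = insert empty_tree ((\<lambda>t. Abs_planar_tree (Some t)) ` C)"
  have "set Ts \<subseteq> B" if "graft Ts = T" for Ts
  proof
    fix S assume S: "S \<in> set Ts"
    show "S \<in> B"
    proof (cases "Rep_planar_tree S")
      case None
      then show ?thesis by (metis B_def Rep_planar_tree_inverse empty_tree_def insertI1)
    next
      case (Some t)
      then have "t \<in> set (nonempty_trees Ts)"
        using S by (force simp: nonempty_trees_def List.map_filter_def)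
      then have "t \<in> C"
        using Rep_graft[of Ts] that by (auto simp: C_def split: list.splits)
      moreover have "S = Abs_planar_tree (Some t)"
        using Some by (metis Rep_planar_tree_inverse)
      ultimately show ?thesis by (simp add: B_def)
    qed
  qed
  then have "{Ts. length Ts = m \<and> graft Ts = T} \<subseteq> {Ts. set Ts \<subseteq> B \<and> length Ts = m}"
    by auto
  moreover have "finite B" by (simp add: B_def C_def split: option.splits)
  ultimately show ?thesis by (rule finite_subset[OF _ finite_lists_length_eq])
qed

definition corona_power :: "nat \<Rightarrow> 'a::field_char_0 planar_series \<Rightarrow> 'a planar_series" where
  "corona_power d f = series_graft (replicate d f)"

definition one_plus_x :: "'a::field_char_0 planar_series" where
  "one_plus_x = (\<lambda>T. monomial empty_tree T + monomial leaf T)"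

definition corona_root :: "nat \<Rightarrow> 'a::field_char_0 planar_series" where
  "corona_root d = (THE f. f empty_tree = 1 \<and> corona_power d f = one_plus_x)"

text \<open>
  The generalized binomial coefficient \<open>C\<^sub>d\<^sup>-\<^sup>1\<close> over \<open>T\<close>. Pitfall: comparing
  coefficients of \<open>x\<close> in \<open>f\<^bsup>C\<^sub>d\<^esup> = 1 + x\<close> gives \<open>1/d\<close> for the one-vertex tree, so every leaf of
  \<open>T\<close> contributes a factor \<open>1/d\<close> to the closed formula. A formula without these factors describes
  the root of \<open>1 + d x\<close> instead.
\<close>

definition corona_binomial :: "nat \<Rightarrow> planar_tree \<Rightarrow> 'a::field_char_0" where
  "corona_binomial d T = corona_root d T"

end

theory Submission
  imports Defs
begin

text \<open>
  Let \<open>f\<close> have constant term 1 and let \<open>t\<close> be a nonempty tree with subtrees \<open>t\<^sub>1, \<dots>, t\<^sub>k\<close> at the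
  children of its root. A \<open>d\<close>-ary grafting yields \<open>t\<close> in two ways only: one argument is \<open>t\<close> and all
  others are empty, or \<open>k \<ge> 2\<close> and the nonempty arguments are \<open>t\<^sub>1, \<dots>, t\<^sub>k\<close>. Hence the coefficient
  of the \<open>C\<^sub>d\<close>-th power of \<open>f\<close> at \<open>t\<close> is \<open>d f(t)\<close>, plus \<open>(d choose k) f(t\<^sub>1) \<cdots> f(t\<^sub>k)\<close> if \<open>k \<ge> 2\<close>.
  The root is therefore determined recursively by \<open>f(x) = 1/d\<close> and
  \<open>f(t) = - (1/d) (d choose k) f(t\<^sub>1) \<cdots> f(t\<^sub>k)\<close>, so \<open>f(t)\<close> is a product over the vertices of \<open>t\<close> of
  weights depending on the arity only, and \<open>(1/d) (d choose k) = (1/k) (d-1 choose k-1)\<close>.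
\<close>

section \<open>Vertices\<close>

lemma ptree_vertices_Node:
  "ptree_vertices (Node ts) = insert [] (\<Union>i<length ts. (#) i ` ptree_vertices (ts ! i))"
proof (rule set_eqI)
  fix p
  show "p \<in> ptree_vertices (Node ts) \<longleftrightarrow>
    p \<in> insert [] (\<Union>i<length ts. (#) i ` ptree_vertices (ts ! i))"
    by (cases p) (auto simp: ptree_vertices_def split: if_splits)
qed

lemma ptree_arity_Nil: "ptree_arity (Node ts) [] = length ts"
  by (simp add: ptree_arity_def)

lemma ptree_arity_Cons: "i < length ts \<Longrightarrow> ptree_arity (Node ts) (i # p) = ptree_arity (ts ! i) p"
  by (simp add: ptree_arity_def)

lemma finite_ptree_vertices: "finite (ptree_vertices t)"
  by (induction t) (auto simp: ptree_vertices_Node)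

lemma finite_vertices: "finite (vertices T)"
  by (simp add: vertices_def finite_ptree_vertices split: option.split)

lemma arity_neq_1: "v \<in> vertices T \<Longrightarrow> arity T v \<noteq> 1"
  using Rep_planar_tree[of T]
  by (auto simp: vertices_def arity_def reduced_def split: option.splits)

text \<open>Every vertex except the root lies in exactly one child subtree. The leading position in
  an address keeps the pieces disjoint even if equal subtrees occur at several positions.\<close>

lemma prod_ptree_vertices_Node:
  fixes w :: "nat \<Rightarrow> 'a::comm_monoid_mult"
  shows "(\<Prod>p\<in>ptree_vertices (Node ts). w (ptree_arity (Node ts) p)) =
    w (length ts) * (\<Prod>t\<leftarrow>ts. \<Prod>p\<in>ptree_vertices t. w (ptree_arity t p))"
proof -
  let ?W = "\<lambda>p. w (ptree_arity (Node ts) p)"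
  have "(\<Prod>p\<in>ptree_vertices (Node ts). ?W p) =
    ?W [] * (\<Prod>p\<in>(\<Union>i<length ts. (#) i ` ptree_vertices (ts ! i)). ?W p)"
    unfolding ptree_vertices_Node
    by (rule prod.insert) (auto simp: finite_ptree_vertices)
  also have "(\<Prod>p\<in>(\<Union>i<length ts. (#) i ` ptree_vertices (ts ! i)). ?W p) =
    (\<Prod>i<length ts. \<Prod>p\<in>(#) i ` ptree_vertices (ts ! i). ?W p)"
    by (rule prod.UNION_disjoint) (auto simp: finite_ptree_vertices)
  also have "\<dots> = (\<Prod>i<length ts. \<Prod>p\<in>ptree_vertices (ts ! i). w (ptree_arity (ts ! i) p))"
    by (rule prod.cong) (auto simp: prod.reindex ptree_arity_Cons)
  also have "\<dots> = (\<Prod>t\<leftarrow>ts. \<Prod>p\<in>ptree_vertices t. w (ptree_arity t p))"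
    by (simp add: prod.list_conv_set_nth atLeast0LessThan)
  finally show ?thesis by (simp add: ptree_arity_Nil)
qed

section \<open>Coefficients of corona powers\<close>

lemma Rep_empty_tree: "Rep_planar_tree empty_tree = None"
  by (simp add: empty_tree_def Abs_planar_tree_inverse)

lemma Rep_planar_tree_eq_None: "Rep_planar_tree T = None \<longleftrightarrow> T = empty_tree"
  by (metis Rep_empty_tree Rep_planar_tree_inject)

lemma Rep_Abs_Some: "reduced t \<Longrightarrow> Rep_planar_tree (Abs_planar_tree (Some t)) = Some t"
  by (simp add: Abs_planar_tree_inverse)

lemma Rep_planar_tree_eq_Some:
  "Rep_planar_tree T = Some t \<longleftrightarrow> reduced t \<and> T = Abs_planar_tree (Some t)"
  using Rep_planar_tree[of T] Rep_planar_tree_inverse[of T] by (auto simp: Rep_Abs_Some)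

lemma planar_tree_cases:
  obtains "T = empty_tree" | t where "reduced t" "T = Abs_planar_tree (Some t)"
  by (metis Rep_planar_tree_eq_None Rep_planar_tree_eq_Some not_None_eq)

section \<open>Argument lists with prescribed nonempty entries\<close>

lemma nonempty_trees_Nil: "nonempty_trees [] = []"
  by (simp add: nonempty_trees_def)

lemma nonempty_trees_Cons:
  "nonempty_trees (T # Ts) =
    (case Rep_planar_tree T of None \<Rightarrow> nonempty_trees Ts | Some t \<Rightarrow> t # nonempty_trees Ts)"
  by (simp add: nonempty_trees_def List.map_filter_def split: option.split)

text \<open>Such a list is determined by the positions of its nonempty entries. Finiteness is
  carried through the induction because the cardinality of a disjoint union requires it.\<close>

lemma card_nonempty_trees_fiber:
  assumes "\<forall>t\<in>set ts. reduced t"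
  shows "finite {Ts. length Ts = d \<and> nonempty_trees Ts = ts} \<and>
    card {Ts. length Ts = d \<and> nonempty_trees Ts = ts} = d choose length ts"
  using assms
proof (induction d arbitrary: ts)
  case 0
  have "{Ts. length Ts = 0 \<and> nonempty_trees Ts = ts} = (if ts = [] then {[]} else {})"
    by (auto simp: nonempty_trees_Nil)
  then show ?case by (cases ts) auto
next
  case (Suc d)
  let ?A = "\<lambda>d ts. {Ts. length Ts = d \<and> nonempty_trees Ts = ts}"
  show ?case
  proof (cases ts)
    case Nil
    have "?A (Suc d) [] = (#) empty_tree ` ?A d []"
      by (auto simp: length_Suc_conv nonempty_trees_Cons Rep_empty_tree Rep_planar_tree_eq_None
          split: option.splits)
    then show ?thesis using Suc.IH[of "[]"] Nil by (simp add: card_image)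
  next
    case (Cons t us)
    let ?t = "Abs_planar_tree (Some t)"
    have t: "reduced t" and us: "\<forall>t\<in>set us. reduced t" using Suc.prems Cons by auto
    \<comment> \<open>Pascal's rule: the first entry is either empty or the first tree of
      \<open>ts\<close>.\<close>
    have eq: "?A (Suc d) ts = (#) empty_tree ` ?A d ts \<union> (#) ?t ` ?A d us"
      using t unfolding Cons
      by (auto simp: length_Suc_conv nonempty_trees_Cons Rep_empty_tree Rep_planar_tree_eq_None
          Rep_planar_tree_eq_Some Rep_Abs_Some split: option.splits)
    have "?t \<noteq> empty_tree" using t by (metis Rep_Abs_Some Rep_empty_tree option.distinct(1))
    then have disj: "(#) empty_tree ` ?A d ts \<inter> (#) ?t ` ?A d us = {}" by auto
    show ?thesis
      unfolding eq using Suc.IH[OF Suc.prems] Suc.IH[OF us] disj Cons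
      by (simp add: card_Un_disjoint card_image)
  qed
qed

lemma prod_list_nonempty_trees:
  fixes f :: "planar_tree \<Rightarrow> 'a::comm_monoid_mult"
  assumes "f empty_tree = 1"
  shows "(\<Prod>T\<leftarrow>Ts. f T) = (\<Prod>t\<leftarrow>nonempty_trees Ts. f (Abs_planar_tree (Some t)))"
  using assms
  by (induction Ts)
    (auto simp: nonempty_trees_Nil nonempty_trees_Cons Rep_planar_tree_eq_None
      Rep_planar_tree_eq_Some split: option.split)

text \<open>Empty arguments contribute the constant term 1, so the summand is constant on the fibre
  and only the number of lists matters.\<close>

lemma sum_nonempty_trees_fiber:
  fixes f :: "'a::field_char_0 planar_series"
  assumes "f empty_tree = 1" "\<forall>t\<in>set ts. reduced t"
  shows "(\<Sum>Ts | length Ts = d \<and> nonempty_trees Ts = ts. \<Prod>T\<leftarrow>Ts. f T) =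
    of_nat (d choose length ts) * (\<Prod>t\<leftarrow>ts. f (Abs_planar_tree (Some t)))"
  using card_nonempty_trees_fiber[OF assms(2)]
  by (simp add: prod_list_nonempty_trees[of f, OF assms(1)])

lemma corona_power_eq_sum:
  "corona_power d f T = (\<Sum>Ts | length Ts = d \<and> graft Ts = T. \<Prod>T\<leftarrow>Ts. f T)"
  unfolding corona_power_def series_graft_def
  by (auto simp: prod.list_conv_set_nth atLeast0LessThan intro!: sum.cong)

lemma graft_eq_empty_tree_iff: "graft Ts = empty_tree \<longleftrightarrow> nonempty_trees Ts = []"
  using Rep_graft[of Ts]
  by (auto simp: Rep_planar_tree_eq_None[symmetric] split: list.splits)

text \<open>A single nonempty argument is returned unchanged, and two or more become the children of
  a new root. The bound 2 matters for the leaf: with no nonempty argument the result is the empty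
  tree, not \<open>Node []\<close>.\<close>

lemma graft_eq_Node_iff:
  assumes "reduced (Node ts)"
  shows "graft Ts = Abs_planar_tree (Some (Node ts)) \<longleftrightarrow>
    nonempty_trees Ts = [Node ts] \<or> length ts \<ge> 2 \<and> nonempty_trees Ts = ts"
proof -
  have "graft Ts = Abs_planar_tree (Some (Node ts)) \<longleftrightarrow> Rep_planar_tree (graft Ts) = Some (Node ts)"
    using assms by (simp add: Rep_planar_tree_eq_Some)
  also have "\<dots> \<longleftrightarrow> nonempty_trees Ts = [Node ts] \<or> length ts \<ge> 2 \<and> nonempty_trees Ts = ts"
    unfolding Rep_graft by (auto split: list.splits)
  finally show ?thesis .
qed

lemma corona_power_empty_tree:
  fixes f :: "'a::field_char_0 planar_series"
  assumes "f empty_tree = 1"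
  shows "corona_power d f empty_tree = 1"
  using sum_nonempty_trees_fiber[of f "[]" d] assms
  by (simp add: corona_power_eq_sum graft_eq_empty_tree_iff)

lemma corona_power_Node:
  fixes f :: "'a::field_char_0 planar_series"
  assumes f: "f empty_tree = 1" and r: "reduced (Node ts)"
  shows "corona_power d f (Abs_planar_tree (Some (Node ts))) =
    of_nat d * f (Abs_planar_tree (Some (Node ts))) +
    (if length ts \<ge> 2
     then of_nat (d choose length ts) * (\<Prod>t\<leftarrow>ts. f (Abs_planar_tree (Some t))) else 0)"
proof -
  let ?A = "\<lambda>ts. {Ts. length Ts = d \<and> nonempty_trees Ts = ts}"
  have ts: "\<forall>t\<in>set ts. reduced t" using r by (simp add: reduced_Node)
  have eq: "{Ts. length Ts = d \<and> graft Ts = Abs_planar_tree (Some (Node ts))} =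
    ?A [Node ts] \<union> (if length ts \<ge> 2 then ?A ts else {})"
    using r by (auto simp: graft_eq_Node_iff)
  have fin: "finite (?A [Node ts])" "finite (?A ts)"
    using card_nonempty_trees_fiber[of _ d] r ts by simp_all
  \<comment> \<open>A common element would force \<open>ts = [Node ts]\<close>, contradicting
    \<open>length ts \<ge> 2\<close>.\<close>
  have disj: "?A [Node ts] \<inter> (if length ts \<ge> 2 then ?A ts else {}) = {}"
  proof -
    have "ts \<noteq> [Node ts]" if "length ts \<ge> 2"
    proof
      assume "ts = [Node ts]"
      then have "length ts = 1" by (metis length_Cons list.size(3) One_nat_def)
      with that show False by simp
    qed
    then show ?thesis by auto
  qed
  have "corona_power d f (Abs_planar_tree (Some (Node ts))) =
    (\<Sum>Ts\<in>?A [Node ts]. \<Prod>T\<leftarrow>Ts. f T) +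
    (\<Sum>Ts\<in>(if length ts \<ge> 2 then ?A ts else {}). \<Prod>T\<leftarrow>Ts. f T)"
    unfolding corona_power_eq_sum eq by (rule sum.union_disjoint) (use fin disj in auto)
  then show ?thesis
    using sum_nonempty_trees_fiber[of f "[Node ts]" d] sum_nonempty_trees_fiber[of f ts d] f r ts
    by simp
qed

section \<open>The corona root\<close>

text \<open>The factor that a vertex of arity \<open>k\<close> contributes to the root. The leaf
  case is separate because the second formula would give 0 there, by division by zero.\<close>

definition corona_weight :: "nat \<Rightarrow> nat \<Rightarrow> 'a::field_char_0" where
  "corona_weight d k =
    (if k = 0 then 1 / of_nat d else - (1 / of_nat k * of_nat ((d - 1) choose (k - 1))))"

text \<open>This is the absorption identity
  \<open>k * (d choose k) = d * ((d - 1) choose (k - 1))\<close>, which brings the weight into the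
  form needed by the recursion.\<close>

lemma of_nat_mult_corona_weight:
  assumes "d > 0"
  shows "of_nat d * (corona_weight d k :: 'a::field_char_0) =
    (if k = 0 then 1 else - of_nat (d choose k))"
proof (cases "k = 0")
  case False
  then have "of_nat k * of_nat (d choose k) = (of_nat d * of_nat ((d - 1) choose (k - 1)) :: 'a)"
    using times_binomial_minus1_eq[of k d] by (metis not_gr_zero of_nat_mult)
  then show ?thesis using False by (simp add: corona_weight_def field_simps)
qed (use assms in \<open>simp add: corona_weight_def\<close>)

definition corona_product :: "nat \<Rightarrow> 'a::field_char_0 planar_series" where
  "corona_product d T = (\<Prod>v\<in>vertices T. corona_weight d (arity T v))"

lemma corona_product_empty_tree: "corona_product d empty_tree = 1"
  by (simp add: corona_product_def vertices_def Rep_empty_tree)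

lemma corona_product_Node:
  assumes "reduced (Node ts)"
  shows "(corona_product d (Abs_planar_tree (Some (Node ts))) :: 'a::field_char_0) =
    corona_weight d (length ts) * (\<Prod>t\<leftarrow>ts. corona_product d (Abs_planar_tree (Some t)))"
proof -
  have *: "(corona_product d (Abs_planar_tree (Some t)) :: 'a) =
    (\<Prod>p\<in>ptree_vertices t. corona_weight d (ptree_arity t p))" if "reduced t" for t
    using that by (simp add: corona_product_def vertices_def arity_def Rep_Abs_Some)
  have "(\<Prod>t\<leftarrow>ts. corona_product d (Abs_planar_tree (Some t)) :: 'a) =
    (\<Prod>t\<leftarrow>ts. \<Prod>p\<in>ptree_vertices t. corona_weight d (ptree_arity t p))"
    using assms by (intro arg_cong[of _ _ prod_list] map_cong) (auto simp: * reduced_Node)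
  then show ?thesis using assms by (simp add: * prod_ptree_vertices_Node)
qed

lemma one_plus_x_empty_tree: "one_plus_x empty_tree = 1"
  using Rep_Abs_Some[of "Node []"] Rep_empty_tree
  by (auto simp: one_plus_x_def monomial_def leaf_def reduced_Node)

lemma one_plus_x_Node:
  assumes "reduced (Node ts)"
  shows "one_plus_x (Abs_planar_tree (Some (Node ts))) = (if ts = [] then 1 else 0)"
proof -
  have "Abs_planar_tree (Some (Node ts)) \<noteq> empty_tree"
    using assms by (metis Rep_Abs_Some Rep_empty_tree option.distinct(1))
  moreover have "Abs_planar_tree (Some (Node ts)) = leaf \<longleftrightarrow> ts = []"
    unfolding leaf_def using assms Rep_Abs_Some[of "Node ts"] Rep_Abs_Some[of "Node []"]
    by (auto simp: reduced_Node)
  ultimately show ?thesis by (simp add: one_plus_x_def monomial_def)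
qed

text \<open>At a leaf, \<open>d\<close> times the weight is 1. At a root of arity
  \<open>k \<ge> 2\<close> it is \<open>- (d choose k)\<close>, so the two terms of
  \<open>corona_power_Node\<close> cancel.\<close>

lemma corona_power_corona_product:
  assumes "d > 0"
  shows "corona_power d (corona_product d) = (one_plus_x :: 'a::field_char_0 planar_series)"
proof
  fix T
  show "corona_power d (corona_product d) T = (one_plus_x T :: 'a)"
  proof (cases T rule: planar_tree_cases)
    case 1
    then show ?thesis
      by (simp add: corona_power_empty_tree corona_product_empty_tree one_plus_x_empty_tree)
  next
    case (2 t)
    obtain ts where t: "t = Node ts" by (cases t)
    then have "length ts \<noteq> 1" using 2 by (simp add: reduced_Node)
    then have "ts = [] \<or> length ts \<ge> 2" by (cases ts; cases "tl ts") auto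
    then show ?thesis
      using 2 assms
      by (auto simp: t corona_power_Node corona_product_empty_tree corona_product_Node
          one_plus_x_Node of_nat_mult_corona_weight mult.assoc[symmetric])
  qed
qed

text \<open>By induction on the tree: its own coefficient enters the power with the factor
  \<open>d\<close>, invertible in characteristic 0, and all other terms involve only proper
  subtrees.\<close>

lemma corona_root_unique:
  fixes f :: "'a::field_char_0 planar_series"
  assumes "d > 0" "f empty_tree = 1" "corona_power d f = one_plus_x"
    and "g empty_tree = 1" "corona_power d g = one_plus_x"
  shows "f = g"
proof
  have eq: "f (Abs_planar_tree (Some t)) = g (Abs_planar_tree (Some t))" if "reduced t" for t
    using that
  proof (induction t)
    case (Node ts)
    have "(\<Prod>t\<leftarrow>ts. f (Abs_planar_tree (Some t))) = (\<Prod>t\<leftarrow>ts. g (Abs_planar_tree (Some t)))"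
      using Node by (intro arg_cong[of _ _ prod_list] map_cong) (auto simp: reduced_Node)
    then have "of_nat d * f (Abs_planar_tree (Some (Node ts))) =
      of_nat d * g (Abs_planar_tree (Some (Node ts)))"
      using corona_power_Node[of f ts d]
        corona_power_Node[of g ts d] Node.prems assms(2-5)
      by (simp split: if_splits)
    then show ?case using assms(1) by simp
  qed
  show "f T = g T" for T
    by (cases T rule: planar_tree_cases) (use assms eq in auto)
qed

lemma corona_root_eq_corona_product:
  assumes "d > 0"
  shows "(corona_root d :: 'a::field_char_0 planar_series) = corona_product d"
  unfolding corona_root_def
  by (rule the_equality)
    (auto simp: assms corona_product_empty_tree corona_power_corona_product
      intro: corona_root_unique[OF assms])

section \<open>Grouping the vertices by arity\<close>

lemma corona_product_eq:
  "(corona_product d T :: 'a::field_char_0) =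
    (-1) ^ (num_vertices T - num_arity 0 T) * (1 / of_nat d) ^ num_arity 0 T *
    (\<Prod>k | k \<ge> 2 \<and> num_arity k T > 0.
       (1 / of_nat k * of_nat ((d - 1) choose (k - 1))) ^ num_arity k T)"
proof -
  let ?V = "vertices T" and ?a = "arity T"
  let ?c = "\<lambda>k. 1 / of_nat k * of_nat ((d - 1) choose (k - 1)) :: 'a"
  define L where "L = {v \<in> ?V. ?a v = 0}"
  define K where "K = {k. k \<ge> 2 \<and> num_arity k T > 0}"
  have L: "L \<subseteq> ?V" "finite L" by (auto simp: L_def finite_vertices)
  have two: "?a v \<ge> 2" if "v \<in> ?V - L" for v
    using arity_neq_1[of v T] that by (auto simp: L_def)
  \<comment> \<open>Identifying the index set with the arities of the inner vertices allows the
    product to be split into the fibres of the arity map.\<close>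
  have K: "K = ?a ` (?V - L)"
  proof
    show "?a ` (?V - L) \<subseteq> K"
      using two finite_vertices[of T] by (fastforce simp: K_def num_arity_def card_gt_0_iff)
    show "K \<subseteq> ?a ` (?V - L)"
      by (auto simp: K_def L_def num_arity_def card_gt_0_iff)
  qed
  have "corona_product d T =
    (\<Prod>v\<in>?V - L. corona_weight d (?a v)) * (\<Prod>v\<in>L. corona_weight d (?a v) :: 'a)"
    unfolding corona_product_def by (rule prod.subset_diff[OF L(1) finite_vertices])
  also have "(\<Prod>v\<in>L. corona_weight d (?a v) :: 'a) = (1 / of_nat d) ^ num_arity 0 T"
    by (simp add: L_def corona_weight_def num_arity_def)
  \<comment> \<open>Each inner vertex gives up a factor -1; collecting these yields the
    sign.\<close>
  also have "(\<Prod>v\<in>?V - L. corona_weight d (?a v) :: 'a) = (\<Prod>v\<in>?V - L. - 1 * ?c (?a v))"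
    by (rule prod.cong) (auto simp: corona_weight_def L_def)
  also have "\<dots> = (-1) ^ card (?V - L) * (\<Prod>v\<in>?V - L. ?c (?a v))"
    unfolding prod.distrib by simp
  also have "card (?V - L) = num_vertices T - num_arity 0 T"
    using L by (simp add: card_Diff_subset num_vertices_def num_arity_def L_def)
  also have "(\<Prod>v\<in>?V - L. ?c (?a v)) = (\<Prod>k\<in>K. \<Prod>v | v \<in> ?V - L \<and> ?a v = k. ?c (?a v))"
    unfolding K by (rule prod.image_gen) (simp add: finite_vertices)
  also have "\<dots> = (\<Prod>k\<in>K. ?c k ^ num_arity k T)"
  proof (rule prod.cong[OF refl])
    fix k assume "k \<in> K"
    \<comment> \<open>Since \<open>k \<ge> 2\<close>, leaving out the leaves does not change the
      fibre.\<close>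
    then have "{v. v \<in> ?V - L \<and> ?a v = k} = {v \<in> ?V. ?a v = k}"
      by (auto simp: K_def L_def)
    then show "(\<Prod>v | v \<in> ?V - L \<and> ?a v = k. ?c (?a v)) = ?c k ^ num_arity k T"
      by (simp add: num_arity_def)
  qed
  finally show ?thesis by (simp add: K_def mult_ac)
qed

text \<open>One factor vanishes: for arity \<open>k > d\<close> the lower index \<open>k - 1\<close>
  of the binomial coefficient exceeds \<open>d - 1\<close>.\<close>

lemma corona_product_eq_0:
  assumes "d > 0" "v \<in> vertices T" "arity T v \<ge> d + 1"
  shows "corona_product d T = 0"
proof -
  have "corona_weight d (arity T v) = 0"
    using assms by (simp add: corona_weight_def binomial_eq_0)
  then show ?thesis
    unfolding corona_product_def using assms(2) by (intro prod_zero) (auto simp: finite_vertices)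
qed

theorem proposition6p3:
  fixes d :: nat and T :: planar_tree
  assumes "d \<ge> 2"
  shows "((\<exists>v\<in>vertices T. arity T v \<ge> d + 1) \<longrightarrow>
            (corona_binomial d T :: 'a::field_char_0) = 0) \<and>
         ((\<forall>v\<in>vertices T. arity T v \<le> d) \<longrightarrow>
            (corona_binomial d T :: 'a) =
              (-1) ^ (num_vertices T - num_arity 0 T) * (1 / of_nat d) ^ num_arity 0 T *
              (\<Prod>k | k \<ge> 2 \<and> num_arity k T > 0.
                 (1 / of_nat k * of_nat ((d - 1) choose (k - 1))) ^ num_arity k T))"
proof -
  have d: "d > 0" using assms by simp
  have eq: "(corona_binomial d T :: 'a) = corona_product d T"
    by (simp add: corona_binomial_def corona_root_eq_corona_product[OF d])
  show ?thesis
    unfolding eq using corona_product_eq_0[OF d] corona_product_eq by blast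
qed

end
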